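(* Suppose that the following three conditions hold. (1) $\|\Pi_W\tilde w\|_D^2\le C_{p,2}\sum_{j=1}^J\|w_j\|_{D_j}^2$ for all $\tilde w=(w_1,\dots,w_J)\in V_1\times\dots\times V_J$, for some constant $C_{p,2}>0$. (2) There is a constant $C_{p,1}>0$ such that for each $w\in V$ there exists $\tilde w=(w_1,\dots,w_J)\in V_1\times\dots\times V_J$ with $w=\Pi_W\tilde w$ and $\sum_{j=1}^J\|w_j\|_{A_j}^2\le C_{p,1}\|w\|_A^2$. (3) $\ker A_j\subset V_j^c$ for all $j$. Then the two-level method with coarse space $V_c=\sum_{j=1}^J\Pi_jV_j^c$ converges with a rate $$\|E\|_A^2\le 1-\frac{\mu_c}{C_{p,1}C_{p,2}\,c^D}.$$
   Context: $V$ is a finite-dimensional real inner product space with inner product $(\cdot,\cdot)$, its dual identified with $V$, and $L'$ denotes the adjoint with respect to $(\cdot,\cdot)$. For a symmetric positive (semi)definite operator $M$, $\|v\|_M^2=(Mv,v)$. $A:V\to V$ is symmetric positive semidefinite. $R:V\to V$ is a smoother whose symmetrization $\bar R=R+R'-R'AR$ is symmetric positive definite, and $(u,v)_{\bar R^{-1}}=(\bar R^{-1}u,v)$. $D:V\to V$ is symmetric positive definite and there are constants $c_D,c^D>0$ with $c_D(Dv,v)\le(\bar R^{-1}v,v)\le c^D(Dv,v)$ for all $v\in V$. $V_1,\dots,V_J$ are finite-dimensional real inner product spaces (not necessarily subspaces of $V$), with linear maps $\Pi_j:V_j\to V$ such that $V=\sum_{j=1}^J\Pi_jV_j$; $\Pi_W(w_1,\dots,w_J)=\sum_{j=1}^J\Pi_jw_j$.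 For each $j$: $A_j$ is a symmetric positive semidefinite operator on $V_j$, $D_j$ is a symmetric positive definite operator on $V_j$, and $V_j^c\subset V_j$ is a subspace. Define $$\mu_j(V_j^c)^{-1}=\max_{v_j\in V_j}\ \min_{v_j^c\in V_j^c}\frac{\|v_j-v_j^c\|_{D_j}^2}{\|v_j\|_{A_j}^2},\qquad \mu_c=\min_{1\le j\le J}\mu_j(V_j^c),$$ where the maximum is over those $v_j$ with $\|v_j\|_{A_j}\ne0$. Two-level method (with exact coarse solver): let $N=\ker A$ (under the three conditions $N\subset V_c$), let $W$ be the orthogonal complement of $N$ with respect to $(\cdot,\cdot)_{\bar R^{-1}}$, $W_c=V_c\cap W$, and let $\Pi_c:V\to W_c$ be defined by $(A\Pi_cu,v_c)=(Au,v_c)$ for all $v_c\in W_c$. The error propagation operator is $E=(I-RA)(I-\Pi_c)$ and $\|E\|_A=\max_{w\in W\setminus\{0\}}\|Ew\|_A/\|w\|_A$.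
   Formalization: The coarse space V_c is additionally assumed to be a proper subspace of V; when V_c = V the stated bound can fail (E = 0 while the right-hand side is negative) or be undefined (mu_c infinite, or W = {0}). *)

theory Defs
  imports "HOL-Analysis.Analysis" "HOL-Library.FuncSet"
begin

text \<open>
  The space \<open>V\<close> is a Euclidean space type.  The auxiliary spaces \<open>V\<^sub>1, \<dots>, V\<^sub>J\<close> have different
  dimensions and are unrelated to \<open>V\<close>; they are modelled as arbitrary subspaces of one further
  Euclidean space type.  This is no restriction, since finitely many finite-dimensional inner
  product spaces embed isometrically into a common one.  Nothing is assumed about an operator
  on \<open>V\<^sub>j\<close> outside \<open>V\<^sub>j\<close>.
\<close>

definition linear_between ::
    "'a::real_vector set \<Rightarrow> 'b::real_vector set \<Rightarrow> ('a \<Rightarrow> 'b) \<Rightarrow> bool" where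
  "linear_between S T f \<longleftrightarrow> (\<forall>x\<in>S. f x \<in> T) \<and>
     (\<forall>x\<in>S. \<forall>y\<in>S. f (x + y) = f x + f y) \<and> (\<forall>c. \<forall>x\<in>S. f (c *\<^sub>R x) = c *\<^sub>R f x)"

definition symmetric_on :: "'a::real_inner set \<Rightarrow> ('a \<Rightarrow> 'a) \<Rightarrow> bool" where
  "symmetric_on S M \<longleftrightarrow> linear_between S S M \<and> (\<forall>u\<in>S. \<forall>v\<in>S. M u \<bullet> v = u \<bullet> M v)"

definition spsd_on :: "'a::real_inner set \<Rightarrow> ('a \<Rightarrow> 'a) \<Rightarrow> bool" where
  "spsd_on S M \<longleftrightarrow> symmetric_on S M \<and> (\<forall>v\<in>S. M v \<bullet> v \<ge> 0)"

definition spd_on :: "'a::real_inner set \<Rightarrow> ('a \<Rightarrow> 'a) \<Rightarrow> bool" where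
  "spd_on S M \<longleftrightarrow> symmetric_on S M \<and> (\<forall>v\<in>S. v \<noteq> 0 \<longrightarrow> M v \<bullet> v > 0)"

definition ker_on :: "'a::real_vector set \<Rightarrow> ('a \<Rightarrow> 'b::real_vector) \<Rightarrow> 'a set" where
  "ker_on S M = {v\<in>S. M v = 0}"

definition op_norm_of :: "('a::real_inner \<Rightarrow> 'a) \<Rightarrow> 'a \<Rightarrow> real" where
  "op_norm_of M v = sqrt (M v \<bullet> v)"

definition symmetrized :: "('a::euclidean_space \<Rightarrow> 'a) \<Rightarrow> ('a \<Rightarrow> 'a) \<Rightarrow> 'a \<Rightarrow> 'a" where
  "symmetrized A R v = R v + adjoint R v - adjoint R (A (R v))"

definition sum_map :: "nat \<Rightarrow> (nat \<Rightarrow> 'b \<Rightarrow> 'a::real_vector) \<Rightarrow> (nat \<Rightarrow> 'b) \<Rightarrow> 'a" where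
  "sum_map J P w = (\<Sum>j\<in>{1..J}. P j (w j))"

definition sum_space :: "nat \<Rightarrow> (nat \<Rightarrow> 'b \<Rightarrow> 'a::real_vector) \<Rightarrow> (nat \<Rightarrow> 'b set) \<Rightarrow> 'a set" where
  "sum_space J P X = sum_map J P ` (\<Pi>\<^sub>E j\<in>{1..J}. X j)"

text \<open>
  The local constant takes values in the extended nonnegative reals: it is \<open>\<infinity>\<close> precisely when the
  max-min is \<open>0\<close> (which includes an empty range for the maximum), so that such a \<open>j\<close> does not
  influence the minimum over \<open>j\<close>.
\<close>
definition local_const ::
    "'b::real_inner set \<Rightarrow> ('b \<Rightarrow> 'b) \<Rightarrow> ('b \<Rightarrow> 'b) \<Rightarrow> 'b set \<Rightarrow> ennreal" where
  "local_const X A D Xc = inverse (SUP v\<in>{v\<in>X. op_norm_of A v \<noteq> 0}. INF vc\<in>Xc.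
     ennreal ((op_norm_of D (v - vc))\<^sup>2 / (op_norm_of A v)\<^sup>2))"

definition coarse_const ::
    "nat \<Rightarrow> (nat \<Rightarrow> 'b::real_inner set) \<Rightarrow> (nat \<Rightarrow> 'b \<Rightarrow> 'b) \<Rightarrow> (nat \<Rightarrow> 'b \<Rightarrow> 'b) \<Rightarrow>
     (nat \<Rightarrow> 'b set) \<Rightarrow> ennreal" where
  "coarse_const J X A D Xc = (MIN j\<in>{1..J}. local_const (X j) (A j) (D j) (Xc j))"

definition kernel_compl :: "('a::euclidean_space \<Rightarrow> 'a) \<Rightarrow> ('a \<Rightarrow> 'a) \<Rightarrow> 'a set" where
  "kernel_compl A R = {w. \<forall>n\<in>ker_on UNIV A. inv (symmetrized A R) w \<bullet> n = 0}"

definition coarse_proj :: "('a::real_inner \<Rightarrow> 'a) \<Rightarrow> 'a set \<Rightarrow> 'a \<Rightarrow> 'a" where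
  "coarse_proj A Wc u = (THE p. p \<in> Wc \<and> (\<forall>v\<in>Wc. A p \<bullet> v = A u \<bullet> v))"

definition error_prop ::
    "('a::euclidean_space \<Rightarrow> 'a) \<Rightarrow> ('a \<Rightarrow> 'a) \<Rightarrow> 'a set \<Rightarrow> 'a \<Rightarrow> 'a" where
  "error_prop A R Vc w = (let u = w - coarse_proj A (Vc \<inter> kernel_compl A R) w in u - R (A u))"

text \<open>The supremum is a maximum, since \<open>A\<close> is positive definite on the finite-dimensional \<open>W\<close>.\<close>
definition energy_norm ::
    "('a::euclidean_space \<Rightarrow> 'a) \<Rightarrow> ('a \<Rightarrow> 'a) \<Rightarrow> ('a \<Rightarrow> 'a) \<Rightarrow> real" where
  "energy_norm A R E = (SUP w\<in>kernel_compl A R - {0}. op_norm_of A (E w) / op_norm_of A w)"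

end

theory Submission
  imports Defs
begin

text \<open>
  Put \<open>u = (I - \<Pi>\<^sub>c) w\<close>.  Then \<open>\<parallel>E w\<parallel>\<^sub>A\<^sup>2 = (A u, u) - (R\<^sub>s A u, A u)\<close>, where \<open>R\<^sub>s\<close> is the
  symmetrized smoother.  Since \<open>ker A \<subseteq> V\<^sub>c\<close>, the residual \<open>A u\<close> is orthogonal to all of \<open>V\<^sub>c\<close>,
  so for every \<open>v\<^sub>c \<in> V\<^sub>c\<close> the Cauchy--Schwarz inequality gives
  \<open>(A u, u)\<^sup>2 = (A u, u - v\<^sub>c)\<^sup>2 \<le> (R\<^sub>s A u, A u) (R\<^sub>s\<^sup>-\<^sup>1 (u - v\<^sub>c), u - v\<^sub>c)\<close>.  Decomposing \<open>u\<close> stably and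
  approximating every component in \<open>V\<^sub>j\<^sup>c\<close> yields a \<open>v\<^sub>c\<close> whose last factor is at most
  \<open>C\<^sub>1 C\<^sub>2 c\<^sup>D / \<mu>\<^sub>c\<close> times \<open>(A u, u)\<close>, whence \<open>(R\<^sub>s A u, A u)\<close> dominates a fixed multiple of \<open>(A u, u)\<close>.
\<close>

section \<open>Operators on a subspace\<close>

lemma linear_between_0:
  assumes "linear_between S T f" "subspace S"
  shows "f 0 = 0"
  using assms unfolding linear_between_def by (metis scale_zero_left subspace_0)

text \<open>Operators on a subspace are unconstrained off it, whereas dimension counts, continuity
  and norm bounds need a map that is linear everywhere. Values prescribed on a basis of
  \<open>S\<close> yield such a stand-in.\<close>

lemma linear_between_extend:
  assumes S: "subspace S" and f: "linear_between S T f"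
  obtains g where "linear g" "\<And>x. x \<in> S \<Longrightarrow> g x = f x"
proof -
  obtain B where B: "B \<subseteq> S" "independent B" "S \<subseteq> span B"
    using maximal_independent_subset by blast
  have spanB: "span B = S"
    using B S by (metis span_minimal subset_antisym)
  obtain g where g: "linear g" "\<And>x. x \<in> B \<Longrightarrow> g x = f x"
    using linear_independent_extend[OF B(2), of f] by blast
  have "x \<in> S \<and> g x = f x" if "x \<in> span B" for x
    using that
  proof (induction rule: span_induct_alt)
    case base
    show ?case using subspace_0[OF S] linear_0[OF g(1)] linear_between_0[OF f S] by simp
  next
    case (step c x y)
    then have "x \<in> S" using B(1) by auto
    then have "c *\<^sub>R x \<in> S" using S subspace_scale by blast
    then show ?case using step f g \<open>x \<in> S\<close> S
      by (simp add: linear_between_def linear_add linear_scale subspace_add)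
  qed
  then show ?thesis using that[of g] g spanB by blast
qed

lemma linear_between_diff:
  assumes f: "linear_between S T f" and S: "subspace S" and "u \<in> S" "v \<in> S"
  shows "f (u - v) = f u - f v"
proof -
  have "f (u + (-1) *\<^sub>R v) = f u + (-1) *\<^sub>R f v"
    using assms subspace_scale[OF S] unfolding linear_between_def by metis
  then show ?thesis by simp
qed

lemma symmetric_on_UNIV_linear: "symmetric_on UNIV M \<Longrightarrow> linear M"
  by (auto simp: symmetric_on_def linear_between_def intro!: linearI)

lemma spd_on_imp_spsd_on:
  assumes "subspace S" "spd_on S M"
  shows "spsd_on S M"
proof -
  have "M v \<bullet> v \<ge> 0" if "v \<in> S" for v
    using assms that by (cases "v = 0") (auto simp: spd_on_def less_imp_le)
  then show ?thesis using assms(2) by (auto simp: spsd_on_def spd_on_def)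
qed

lemma op_norm_of_power2: "spsd_on S M \<Longrightarrow> v \<in> S \<Longrightarrow> (op_norm_of M v)\<^sup>2 = M v \<bullet> v"
  by (simp add: spsd_on_def op_norm_of_def)

text \<open>The usual discriminant argument for the quadratic in \<open>t\<close> given by the
  energy of \<open>u + t v\<close>; the form may be degenerate, so a vanishing leading coefficient
  is treated separately.\<close>

lemma spsd_on_Cauchy_Schwarz:
  assumes S: "subspace S" and M: "spsd_on S M" and u: "u \<in> S" and v: "v \<in> S"
  shows "(M u \<bullet> v)\<^sup>2 \<le> (M u \<bullet> u) * (M v \<bullet> v)"
proof -
  have q: "0 \<le> M u \<bullet> u + 2 * t * (M u \<bullet> v) + t\<^sup>2 * (M v \<bullet> v)" for t
  proof -
    have tv: "t *\<^sub>R v \<in> S" using S v subspace_scale by blast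
    have "M (u + t *\<^sub>R v) = M u + t *\<^sub>R M v"
      using M u v tv unfolding spsd_on_def symmetric_on_def linear_between_def by metis
    moreover have "M v \<bullet> u = M u \<bullet> v"
      using M u v unfolding spsd_on_def symmetric_on_def by (metis inner_commute)
    moreover have "0 \<le> M (u + t *\<^sub>R v) \<bullet> (u + t *\<^sub>R v)"
      using M u tv S subspace_add unfolding spsd_on_def by blast
    ultimately show ?thesis
      by (simp add: inner_simps algebra_simps power2_eq_square)
  qed
  define a b c where "a = M u \<bullet> u" and "b = M u \<bullet> v" and "c = M v \<bullet> v"
  have q': "0 \<le> a + 2 * t * b + t\<^sup>2 * c" for t using q[of t] by (simp add: a_def b_def c_def)
  have c0: "c \<ge> 0" using M v by (simp add: spsd_on_def c_def)
  have "b\<^sup>2 \<le> a * c"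
  proof (cases "c = 0")
    case True
    have "b = 0"
    proof (rule ccontr)
      assume "b \<noteq> 0"
      \<comment> \<open>With \<open>c = 0\<close> the quadratic is affine in \<open>t\<close>, and
        this \<open>t\<close> gives it the value -1.\<close>
      then show False using q'[of "- (a + 1) / (2 * b)"] True by (simp add: field_simps)
    qed
    then show ?thesis using True by simp
  next
    case False
    then have "c > 0" using c0 by simp
    \<comment> \<open>\<open>t = - b / c\<close> is the minimiser of the quadratic.\<close>
    have "0 \<le> c * (a + 2 * (- b / c) * b + (- b / c)\<^sup>2 * c)"
      using q'[of "- b / c"] \<open>c > 0\<close> by simp
    also have "\<dots> = a * c - b\<^sup>2" using \<open>c > 0\<close> by (simp add: field_simps power2_eq_square)
    finally show ?thesis by simp
  qed
  then show ?thesis by (simp add: a_def b_def c_def)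
qed

text \<open>Cauchy-Schwarz against \<open>v = M u\<close> bounds the square of
  \<open>M u \<bullet> M u\<close> by 0. Vectors of zero energy therefore lie in the kernel.\<close>

lemma spsd_on_eq_0:
  assumes S: "subspace S" and M: "spsd_on S M" and u: "u \<in> S" and "M u \<bullet> u = 0"
  shows "M u = 0"
proof -
  have "M u \<in> S" using M u by (auto simp: spsd_on_def symmetric_on_def linear_between_def)
  from spsd_on_Cauchy_Schwarz[OF S M u this] show ?thesis using assms(4) by simp
qed

lemma subspace_ker_on:
  assumes S: "subspace S" and f: "linear_between S T f"
  shows "subspace (ker_on S f)"
  using assms linear_between_0[OF f S]
  by (auto simp: subspace_def ker_on_def linear_between_def)

text \<open>Solvability of a Galerkin problem on \<open>S\<close>. The values of \<open>M\<close>
  may leave \<open>S\<close>, so it is followed by the orthogonal projection \<open>pr\<close> onto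
  \<open>S\<close>; definiteness makes the composite injective on \<open>S\<close>, and equality of
  dimensions makes it onto.\<close>

lemma definite_form_represents:
  fixes M :: "'a::euclidean_space \<Rightarrow> 'a"
  assumes S: "subspace S" and M: "linear_between S T M"
    and pos: "\<And>v. v \<in> S \<Longrightarrow> v \<noteq> 0 \<Longrightarrow> M v \<bullet> v > 0"
  obtains p where "p \<in> S" "\<And>v. v \<in> S \<Longrightarrow> M p \<bullet> v = y \<bullet> v"
proof -
  obtain L where L: "linear L" "\<And>x. x \<in> S \<Longrightarrow> L x = M x"
    using linear_between_extend[OF S M] by blast
  obtain B where B: "B \<subseteq> S" "pairwise orthogonal B" "\<And>x. x \<in> B \<Longrightarrow> norm x = 1"
    "independent B" "span B = S"
    using orthonormal_basis_subspace[OF S] by metis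
  have fin: "finite B" using B(4) independent_imp_finite by blast
  define pr where "pr x = (\<Sum>b\<in>B. (x \<bullet> b) *\<^sub>R b)" for x
  have pr_S: "pr x \<in> S" for x
    unfolding pr_def using B(1) S by (auto intro!: subspace_sum subspace_scale)
  have pr_b: "pr x \<bullet> b = x \<bullet> b" if "b \<in> B" for x b
  proof -
    have "pr x \<bullet> b = (\<Sum>c\<in>B. (x \<bullet> c) * (c \<bullet> b))"
      by (simp add: pr_def inner_sum_left)
    also have "\<dots> = (\<Sum>c\<in>B. if c = b then x \<bullet> b else 0)"
    proof (rule sum.cong[OF refl])
      fix c assume "c \<in> B"
      then show "(x \<bullet> c) * (c \<bullet> b) = (if c = b then x \<bullet> b else 0)"
        using B(3)[of b] pairwiseD[OF B(2), of c b] that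
        by (simp add: orthogonal_def dot_square_norm)
    qed
    finally show ?thesis using fin that by simp
  qed
  have pr_v: "pr x \<bullet> v = x \<bullet> v" if "v \<in> S" for x v
  proof -
    have "v \<in> span B" using that B(5) by simp
    then show ?thesis
      by (induction rule: span_induct_alt) (simp_all add: inner_add_right pr_b)
  qed
  have "linear pr"
    unfolding pr_def[abs_def]
    by (rule linearI)
      (simp_all add: inner_add_left scaleR_add_left sum.distrib scaleR_sum_right)
  then have lin: "linear (\<lambda>x. pr (L x))"
    using linear_compose[OF L(1)] by (simp add: o_def)
  have inj: "inj_on (\<lambda>x. pr (L x)) (span S)"
  proof (rule inj_onI)
    fix x z assume "x \<in> span S" "z \<in> span S" and eq: "pr (L x) = pr (L z)"
    then have d: "x - z \<in> S" using S by (metis span_eq_iff subspace_diff)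
    have "L (x - z) \<bullet> (x - z) = pr (L (x - z)) \<bullet> (x - z)" using pr_v[OF d] by simp
    also have "\<dots> = 0" using linear_diff[OF lin, of x z] eq by simp
    finally show "x = z" using pos[OF d] L(2)[OF d] by force
  qed
  have "dim ((\<lambda>x. pr (L x)) ` S) = dim S"
    using dim_image_eq[OF lin inj] .
  moreover have "(\<lambda>x. pr (L x)) ` S \<subseteq> S" using pr_S by blast
  ultimately have "(\<lambda>x. pr (L x)) ` S = S"
    using subspace_dim_equal[OF linear_subspace_image[OF lin S] S] by simp
  then have "pr y \<in> (\<lambda>x. pr (L x)) ` S" using pr_S[of y] by simp
  then obtain p where p: "p \<in> S" "pr (L p) = pr y" by (elim imageE) simp
  show ?thesis
  proof (rule that[OF p(1)])
    fix v assume "v \<in> S"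
    then show "M p \<bullet> v = y \<bullet> v"
      using pr_v[of v "L p"] pr_v[of v y] p(2) L(2)[OF p(1)] by simp
  qed
qed

text \<open>\<open>inv\<close> is defined by choice. Definiteness gives injectivity and finite
  dimension then surjectivity, so here it is a genuine two-sided inverse.\<close>

lemma spd_on_inv:
  fixes M :: "'a::euclidean_space \<Rightarrow> 'a"
  assumes M: "spd_on UNIV M"
  shows "spd_on UNIV (inv M)" "M (inv M x) = x"
proof -
  have lin: "linear M" using M symmetric_on_UNIV_linear by (auto simp: spd_on_def)
  have "inj M"
  proof (subst linear_injective_0[OF lin], intro allI impI)
    fix x assume "M x = 0"
    then show "x = 0" using M unfolding spd_on_def by (metis UNIV_I inner_zero_left less_irrefl)
  qed
  then have surj: "surj M" using linear_injective_imp_surjective lin by blast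
  have r: "M (inv M x) = x" for x using surj surj_f_inv_f by metis
  have l: "inv M (M x) = x" for x using \<open>inj M\<close> by simp
  have sym: "M u \<bullet> v = u \<bullet> M v" for u v
    using M by (simp add: spd_on_def symmetric_on_def)
  have "inv M u \<bullet> v = u \<bullet> inv M v" for u v
    using sym[of "inv M u" "inv M v"] by (simp add: r)
  moreover have "inv M (u + v) = inv M u + inv M v" for u v
    using l[of "inv M u + inv M v"] by (simp add: linear_add[OF lin] r)
  moreover have "inv M (c *\<^sub>R u) = c *\<^sub>R inv M u" for c u
    using l[of "c *\<^sub>R inv M u"] by (simp add: linear_scale[OF lin] r)
  moreover have "inv M v \<bullet> v > 0" if "v \<noteq> 0" for v
  proof -
    have "inv M v \<noteq> 0" using r[of v] that linear_0[OF lin] by metis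
    then have "M (inv M v) \<bullet> inv M v > 0" using M by (simp add: spd_on_def)
    then show ?thesis by (simp add: r inner_commute)
  qed
  ultimately show "spd_on UNIV (inv M)"
    by (auto simp: spd_on_def symmetric_on_def linear_between_def)
  show "M (inv M x) = x" by (rule r)
qed

text \<open>Cauchy-Schwarz for \<open>M\<close> at the vectors \<open>y\<close> and
  \<open>inv M z\<close>, whose \<open>M\<close>-product is \<open>y \<bullet> z\<close>.\<close>

lemma dual_Cauchy_Schwarz:
  fixes M :: "'a::euclidean_space \<Rightarrow> 'a"
  assumes M: "spd_on UNIV M"
  shows "(y \<bullet> z)\<^sup>2 \<le> (M y \<bullet> y) * (inv M z \<bullet> z)"
proof -
  have "M y \<bullet> inv M z = y \<bullet> z"
    using M spd_on_inv(2)[OF M, of z] by (simp add: spd_on_def symmetric_on_def)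
  then show ?thesis
    using spsd_on_Cauchy_Schwarz[OF _ spd_on_imp_spsd_on[OF _ M], of y "inv M z"]
    by (simp add: spd_on_inv(2)[OF M] inner_commute)
qed

text \<open>The minimiser is the \<open>M\<close>-orthogonal projection of \<open>v\<close> onto
  \<open>T\<close>, and optimality is Pythagoras. Attainment lets the infimum inside
  \<open>local_const\<close> be replaced by an actual coarse vector.\<close>

lemma spd_on_best_approximation:
  fixes M :: "'a::euclidean_space \<Rightarrow> 'a"
  assumes S: "subspace S" and M: "spd_on S M" and T: "subspace T" "T \<subseteq> S" and v: "v \<in> S"
  obtains p where "p \<in> T" "\<And>t. t \<in> T \<Longrightarrow> M (v - p) \<bullet> (v - p) \<le> M (v - t) \<bullet> (v - t)"
proof -
  have lb: "linear_between S S M" and sym: "\<And>x y. x \<in> S \<Longrightarrow> y \<in> S \<Longrightarrow> M x \<bullet> y = x \<bullet> M y"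
    using M by (auto simp: spd_on_def symmetric_on_def)
  have lbT: "linear_between T S M"
    using lb T(2) unfolding linear_between_def by (meson subsetD)
  obtain p where p: "p \<in> T" "\<And>t. t \<in> T \<Longrightarrow> M p \<bullet> t = M v \<bullet> t"
    using definite_form_represents[OF T(1) lbT, of "M v"] M T(2)
    unfolding spd_on_def by blast
  have "M (v - p) \<bullet> (v - p) \<le> M (v - t) \<bullet> (v - t)" if t: "t \<in> T" for t
  proof -
    define e d where "e = v - p" and "d = p - t"
    have dT: "d \<in> T" using p t T(1) subspace_diff by (auto simp: d_def)
    have eS: "e \<in> S" using p(1) T(2) subspace_diff[OF S v] by (auto simp: e_def)
    have dS: "d \<in> S" using dT T(2) by auto
    have "M e = M v - M p"
      unfolding e_def using linear_between_diff[OF lb S v] p T(2) by auto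
    then have o: "M e \<bullet> d = 0" using p(2)[OF dT] by (simp add: inner_simps)
    then have o': "M d \<bullet> e = 0" using sym[OF eS dS] by (simp add: inner_commute)
    have "M (e + d) = M e + M d" using lb eS dS by (simp add: linear_between_def)
    moreover have "M d \<bullet> d \<ge> 0"
      using spd_on_imp_spsd_on[OF S M] dS by (simp add: spsd_on_def)
    moreover have "v - t = e + d" by (simp add: e_def d_def)
    ultimately show ?thesis using o o' by (simp add: inner_simps e_def[symmetric])
  qed
  then show ?thesis using that p(1) by blast
qed

section \<open>The local constants\<close>

lemma ennreal_inverse_inverse: "inverse (inverse x) = (x :: ennreal)"
proof (cases x)
  case (real r)
  then show ?thesis by (cases "r = 0") (simp_all add: inverse_ennreal)
qed simp

lemma ennreal_inverse_antimono:
  assumes "x \<le> y"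
  shows "inverse y \<le> inverse (x :: ennreal)"
  using assms
  by (simp add: less_eq_ennreal.rep_eq inverse_ennreal.rep_eq ereal_inverse_antimono)

text \<open>Subtracting the Euclidean projection \<open>n\<close> of \<open>v\<close> onto the
  kernel leaves the energy unchanged and lands in the complement \<open>Q\<close>, where
  \<open>A\<close> is definite. By compactness its energy on unit vectors of \<open>Q\<close> has a
  positive lower bound \<open>m\<close>.\<close>

lemma kernel_approximation_bound:
  fixes A D :: "'b::euclidean_space \<Rightarrow> 'b"
  assumes S: "subspace S" and A: "spsd_on S A" and D: "linear_between S S D"
  obtains C where "C \<ge> 0"
    "\<And>v. v \<in> S \<Longrightarrow> \<exists>n\<in>ker_on S A. D (v - n) \<bullet> (v - n) \<le> C * (A v \<bullet> v)"
proof -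
  have lb: "linear_between S S A" and sym: "\<And>x y. x \<in> S \<Longrightarrow> y \<in> S \<Longrightarrow> A x \<bullet> y = x \<bullet> A y"
    using A by (auto simp: spsd_on_def symmetric_on_def)
  obtain A' where A': "linear A'" "\<And>x. x \<in> S \<Longrightarrow> A' x = A x"
    using linear_between_extend[OF S lb] by blast
  obtain D' where D': "linear D'" "\<And>x. x \<in> S \<Longrightarrow> D' x = D x"
    using linear_between_extend[OF S D] by blast
  define K where "K = ker_on S A"
  have K: "subspace K" "K \<subseteq> S"
    using subspace_ker_on[OF S lb] by (auto simp: K_def ker_on_def)
  define Q where "Q = {v \<in> S. \<forall>k\<in>K. k \<bullet> v = 0}"
  have Q: "subspace Q"
    using S by (auto simp: Q_def subspace_def inner_simps)
  define T where "T = Q \<inter> sphere 0 1"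
  have "compact T" unfolding T_def
    using closed_subspace[OF Q] compact_sphere by (intro closed_Int_compact) auto
  have Apos: "A' v \<bullet> v > 0" if "v \<in> T" for v
  proof -
    have vS: "v \<in> S" and vQ: "v \<in> Q" and "norm v = 1" using that by (auto simp: T_def Q_def)
    have "A v \<bullet> v \<noteq> 0"
    proof
      assume "A v \<bullet> v = 0"
      then have "v \<in> K" using spsd_on_eq_0[OF S A vS] vS by (simp add: K_def ker_on_def)
      then have "v \<bullet> v = 0" using vQ by (auto simp: Q_def)
      then show False using \<open>norm v = 1\<close> by simp
    qed
    moreover have "A v \<bullet> v \<ge> 0" using A vS by (simp add: spsd_on_def)
    ultimately show ?thesis using A'(2)[OF vS] by simp
  qed
  obtain m where m: "m > 0" "\<And>v. v \<in> T \<Longrightarrow> m \<le> A' v \<bullet> v"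
  proof (cases "T = {}")
    case True
    \<comment> \<open>Here \<open>Q\<close> is trivial, and any positive \<open>m\<close>
      serves.\<close>
    then show ?thesis using that[of 1] by simp
  next
    case False
    have "continuous_on T (\<lambda>v. A' v \<bullet> v)"
      using linear_continuous_on[of A' T] A'(1) linear_conv_bounded_linear
      by (intro continuous_intros) auto
    then obtain z where "z \<in> T" "\<And>v. v \<in> T \<Longrightarrow> A' z \<bullet> z \<le> A' v \<bullet> v"
      using continuous_attains_inf[OF \<open>compact T\<close> False] by blast
    then show ?thesis using that[of "A' z \<bullet> z"] Apos by blast
  qed
  have mQ: "m * (v \<bullet> v) \<le> A v \<bullet> v" if "v \<in> Q" for v
  proof (cases "v = 0")
    case False
    have "(1 / norm v) *\<^sub>R v \<in> T"
      using that subspace_scale[OF Q] False by (auto simp: T_def)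
    then have "m \<le> A' ((1 / norm v) *\<^sub>R v) \<bullet> ((1 / norm v) *\<^sub>R v)" by (rule m(2))
    also have "\<dots> = (A' v \<bullet> v) / (v \<bullet> v)"
      by (simp add: linear_scale[OF A'(1)] dot_square_norm power2_eq_square)
    finally have "m * (v \<bullet> v) \<le> A' v \<bullet> v" using False by (simp add: field_simps)
    then show ?thesis using A'(2) that by (simp add: Q_def)
  qed simp
  obtain B where B: "B > 0" "\<And>x. norm (D' x) \<le> B * norm x"
    using linear_bounded_pos[OF D'(1)] by blast
  \<comment> \<open>\<open>B\<close> bounds \<open>D\<close> on \<open>S\<close> from above and
    \<open>m\<close> bounds \<open>A\<close> on \<open>Q\<close> from below, whence the constant
    \<open>B / m\<close>.\<close>
  show ?thesis
  proof (rule that[of "B / m"])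
    show "B / m \<ge> 0" using B m by simp
    fix v assume v: "v \<in> S"
    obtain n q where nq: "n \<in> span K" "\<And>w. w \<in> span K \<Longrightarrow> orthogonal q w" "v = n + q"
      using orthogonal_subspace_decomp_exists[of K v] by metis
    have nK: "n \<in> K" using nq(1) K(1) by (metis span_eq_iff)
    have nS: "n \<in> S" using nK K(2) by auto
    have qS: "q \<in> S" using nq(3) v nS S by (metis add_diff_cancel_left' subspace_diff)
    have qQ: "q \<in> Q" using qS nq(2) span_base
      by (auto simp: Q_def orthogonal_def inner_commute)
    have "A n = 0" using nK by (simp add: K_def ker_on_def)
    have "A v = A q"
      using lb nS qS \<open>A n = 0\<close> by (simp add: nq(3) linear_between_def)
    then have Av: "A v \<bullet> v = A q \<bullet> q"
      using sym[OF qS nS] \<open>A n = 0\<close> by (simp add: nq(3) inner_simps)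
    have "D q \<bullet> q \<le> norm (D q) * norm q" by (rule norm_cauchy_schwarz)
    also have "\<dots> \<le> (B * norm q) * norm q"
      using B(2)[of q] D'(2)[OF qS] by (intro mult_right_mono) auto
    also have "\<dots> = (B / m) * (m * (q \<bullet> q))"
      using m by (simp add: dot_square_norm power2_eq_square)
    also have "\<dots> \<le> (B / m) * (A q \<bullet> q)"
      using mQ[OF qQ] B m by (intro mult_left_mono) auto
    finally have "D (v - n) \<bullet> (v - n) \<le> B / m * (A v \<bullet> v)"
      using Av nq(3) by simp
    then show "\<exists>n\<in>ker_on S A. D (v - n) \<bullet> (v - n) \<le> B / m * (A v \<bullet> v)"
      using nK K_def by blast
  qed
qed

text \<open>The kernel vector from \<open>kernel_approximation_bound\<close> is an admissible
  competitor because \<open>T\<close> contains the kernel. The supremum is thus finite and its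
  reciprocal positive.\<close>

lemma local_const_pos:
  fixes A D :: "'b::euclidean_space \<Rightarrow> 'b"
  assumes S: "subspace S" and A: "spsd_on S A" and D: "spd_on S D"
    and T: "subspace T" "T \<subseteq> S" and ker: "ker_on S A \<subseteq> T"
  shows "local_const S A D T > 0"
proof -
  have Dps: "spsd_on S D" using spd_on_imp_spsd_on[OF S D] .
  have "linear_between S S D" using D by (auto simp: spd_on_def symmetric_on_def)
  then obtain C where C: "C \<ge> 0"
    "\<And>v. v \<in> S \<Longrightarrow> \<exists>n\<in>ker_on S A. D (v - n) \<bullet> (v - n) \<le> C * (A v \<bullet> v)"
    using kernel_approximation_bound[OF S A] by blast
  have "(SUP v\<in>{v\<in>S. op_norm_of A v \<noteq> 0}. INF vc\<in>T.
     ennreal ((op_norm_of D (v - vc))\<^sup>2 / (op_norm_of A v)\<^sup>2)) \<le> ennreal C"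
  proof (rule SUP_least)
    fix v assume "v \<in> {v\<in>S. op_norm_of A v \<noteq> 0}"
    then have v: "v \<in> S" "op_norm_of A v \<noteq> 0" by auto
    obtain n where n: "n \<in> ker_on S A" "D (v - n) \<bullet> (v - n) \<le> C * (A v \<bullet> v)"
      using C(2)[OF v(1)] by blast
    have nT: "n \<in> T" using n ker by auto
    have vn: "v - n \<in> S" using nT T(2) subspace_diff[OF S v(1)] by auto
    have "(op_norm_of A v)\<^sup>2 > 0" using v(2) by simp
    then have "(op_norm_of D (v - n))\<^sup>2 / (op_norm_of A v)\<^sup>2 \<le> C"
      using n(2) op_norm_of_power2[OF Dps vn] op_norm_of_power2[OF A v(1)]
      by (simp add: pos_divide_le_eq)
    then show "(INF vc\<in>T. ennreal ((op_norm_of D (v - vc))\<^sup>2 / (op_norm_of A v)\<^sup>2)) \<le> ennreal C"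
      using nT by (intro INF_lower2[of n]) (auto intro: ennreal_leI)
  qed
  then have "(SUP v\<in>{v\<in>S. op_norm_of A v \<noteq> 0}. INF vc\<in>T.
     ennreal ((op_norm_of D (v - vc))\<^sup>2 / (op_norm_of A v)\<^sup>2)) \<noteq> top"
    using ennreal_less_top[of C] by (metis leD)
  then show ?thesis
    unfolding local_const_def by (simp add: ennreal_inverse_positive)
qed

text \<open>Unfolds the max-min into a multiplicative bound that also covers the zero-energy vectors
  left out of the supremum: they lie in the kernel, hence in \<open>T\<close>. A real bound
  \<open>M\<close> on the reciprocal admits \<open>M = 0\<close>, the case of an infinite local
  constant.\<close>

lemma local_approximation:
  fixes A D :: "'b::euclidean_space \<Rightarrow> 'b"
  assumes S: "subspace S" and A: "spsd_on S A" and D: "spd_on S D"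
    and T: "subspace T" "T \<subseteq> S" and ker: "ker_on S A \<subseteq> T"
    and M: "inverse (local_const S A D T) \<le> ennreal M" "M \<ge> 0" and v: "v \<in> S"
  shows "\<exists>t\<in>T. D (v - t) \<bullet> (v - t) \<le> M * (A v \<bullet> v)"
proof (cases "A v \<bullet> v = 0")
  case True
  then have "v \<in> T" using spsd_on_eq_0[OF S A v] v ker by (auto simp: ker_on_def)
  then show ?thesis using True by (intro bexI[of _ v]) auto
next
  case False
  have Dps: "spsd_on S D" using spd_on_imp_spsd_on[OF S D] .
  obtain p where p: "p \<in> T" "\<And>t. t \<in> T \<Longrightarrow> D (v - p) \<bullet> (v - p) \<le> D (v - t) \<bullet> (v - t)"
    using spd_on_best_approximation[OF S D T v] by blast
  have Av: "A v \<bullet> v > 0" using False A v by (force simp: spsd_on_def)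
  have diff: "v - t \<in> S" if "t \<in> T" for t using that T(2) subspace_diff[OF S v] by auto
  have nz: "op_norm_of A v \<noteq> 0" using Av by (simp add: op_norm_of_def)
  \<comment> \<open>Since \<open>p\<close> minimises the numerator, its quotient is below every
    member of the infimum.\<close>
  have "ennreal ((D (v - p) \<bullet> (v - p)) / (A v \<bullet> v))
      \<le> (INF t\<in>T. ennreal ((op_norm_of D (v - t))\<^sup>2 / (op_norm_of A v)\<^sup>2))"
    using p(2) op_norm_of_power2[OF Dps diff] op_norm_of_power2[OF A v] Av
    by (intro INF_greatest ennreal_leI) (simp add: divide_right_mono)
  also have "\<dots> \<le> (SUP v\<in>{v\<in>S. op_norm_of A v \<noteq> 0}. INF t\<in>T.
     ennreal ((op_norm_of D (v - t))\<^sup>2 / (op_norm_of A v)\<^sup>2))"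
    using v nz by (intro SUP_upper) auto
  also have "\<dots> \<le> ennreal M" using M(1) by (simp add: local_const_def ennreal_inverse_inverse)
  finally have "(D (v - p) \<bullet> (v - p)) / (A v \<bullet> v) \<le> M" using M(2) by simp
  then show ?thesis using p(1) Av by (intro bexI[of _ p]) (auto simp: divide_le_eq)
qed

section \<open>Sums of mapped spaces\<close>

lemma subspace_sum_space:
  assumes X: "\<And>j. j \<in> {1..J} \<Longrightarrow> subspace (X j)"
    and P: "\<And>j. j \<in> {1..J} \<Longrightarrow> linear_between (X j) UNIV (P j)"
  shows "subspace (sum_space J P X)"
  unfolding subspace_def
proof (intro conjI ballI allI)
  have "P j 0 = 0" "0 \<in> X j" if "j \<in> {1..J}" for j
    using linear_between_0[OF P X] subspace_0[OF X] that by blast+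
  then show "0 \<in> sum_space J P X"
    unfolding sum_space_def sum_map_def
    \<comment> \<open>Members of \<open>\<Pi>\<^sub>E\<close> are \<open>undefined\<close> off the
      index set, so the witness is a restricted function.\<close>
    by (intro image_eqI[of _ _ "\<lambda>j\<in>{1..J}. 0"]) auto
next
  fix x y assume "x \<in> sum_space J P X" "y \<in> sum_space J P X"
  then obtain u v where "u \<in> (\<Pi>\<^sub>E j\<in>{1..J}. X j)" "v \<in> (\<Pi>\<^sub>E j\<in>{1..J}. X j)"
    "x = sum_map J P u" "y = sum_map J P v"
    by (auto simp: sum_space_def)
  moreover from this have "u j + v j \<in> X j" "P j (u j + v j) = P j (u j) + P j (v j)"
    if "j \<in> {1..J}" for j
    using P[OF that] subspace_add[OF X[OF that]] PiE_mem[of u "{1..J}" X j]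
      PiE_mem[of v "{1..J}" X j] that by (simp_all add: linear_between_def)
  ultimately show "x + y \<in> sum_space J P X"
    unfolding sum_space_def sum_map_def
    by (intro image_eqI[of _ _ "\<lambda>j\<in>{1..J}. u j + v j"]) (auto simp: sum.distrib[symmetric])
next
  fix c x assume "x \<in> sum_space J P X"
  then obtain u where "u \<in> (\<Pi>\<^sub>E j\<in>{1..J}. X j)" "x = sum_map J P u"
    by (auto simp: sum_space_def)
  moreover from this have "c *\<^sub>R u j \<in> X j" "P j (c *\<^sub>R u j) = c *\<^sub>R P j (u j)"
    if "j \<in> {1..J}" for j
    using P[OF that] subspace_scale[OF X[OF that]] PiE_mem[of u "{1..J}" X j] that
    by (simp_all add: linear_between_def)
  ultimately show "c *\<^sub>R x \<in> sum_space J P X"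
    unfolding sum_space_def sum_map_def
    by (intro image_eqI[of _ _ "\<lambda>j\<in>{1..J}. c *\<^sub>R u j"]) (auto simp: scaleR_sum_right)
qed

section \<open>The two-level method\<close>

text \<open>With \<open>y = A u\<close>, both cross terms of the expanded energy equal
  \<open>R y \<bullet> y\<close>; together with the quadratic term they form the energy of
  \<open>y\<close> under the symmetrized smoother.\<close>

lemma smoother_energy:
  assumes A: "spsd_on UNIV A" and R: "linear R"
  shows "A (u - R (A u)) \<bullet> (u - R (A u)) = A u \<bullet> u - symmetrized A R (A u) \<bullet> A u"
proof -
  have linA: "linear A" and sym: "\<And>x y. A x \<bullet> y = x \<bullet> A y"
    using A symmetric_on_UNIV_linear by (auto simp: spsd_on_def symmetric_on_def)
  have adj: "adjoint R x \<bullet> y = x \<bullet> R y" for x y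
    using adjoint_works[OF R, of y x] by (simp add: inner_commute)
  define y where "y = A u"
  have "A (R y) \<bullet> u = R y \<bullet> y" "y \<bullet> R y = R y \<bullet> y"
    by (simp_all only: sym y_def inner_commute)
  then show ?thesis
    by (simp add: symmetrized_def linear_diff[OF linA] inner_simps adj flip: y_def)
qed

lemma subspace_kernel_compl:
  assumes "spd_on UNIV (symmetrized A R)"
  shows "subspace (kernel_compl A R)"
proof -
  have "linear (inv (symmetrized A R))"
    using spd_on_inv(1)[OF assms] symmetric_on_UNIV_linear by (auto simp: spd_on_def)
  then show ?thesis
    by (auto simp: subspace_def kernel_compl_def linear_0 linear_add linear_scale inner_simps)
qed

text \<open>\<open>n\<close> is the projection of \<open>v\<close> onto the kernel in the inner
  product of the inverse symmetrized smoother.\<close>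

lemma kernel_compl_decomp:
  fixes A R :: "'a::euclidean_space \<Rightarrow> 'a"
  assumes A: "spsd_on UNIV A" and R: "spd_on UNIV (symmetrized A R)"
  obtains n w where "n \<in> ker_on UNIV A" "w \<in> kernel_compl A R" "v = n + w"
proof -
  let ?S = "inv (symmetrized A R)"
  have S: "spd_on UNIV ?S" using spd_on_inv(1)[OF R] .
  then have linS: "linear ?S" using symmetric_on_UNIV_linear by (auto simp: spd_on_def)
  have N: "subspace (ker_on UNIV A)"
    using A by (auto simp: spsd_on_def symmetric_on_def intro: subspace_ker_on)
  have "linear_between (ker_on UNIV A) UNIV ?S"
    using linS by (auto simp: linear_between_def linear_add linear_scale)
  then obtain p where p: "p \<in> ker_on UNIV A" "\<And>n. n \<in> ker_on UNIV A \<Longrightarrow> ?S p \<bullet> n = ?S v \<bullet> n"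
    using definite_form_represents[OF N, of UNIV ?S "?S v"] S unfolding spd_on_def by blast
  have "v - p \<in> kernel_compl A R"
    using p(2) by (auto simp: kernel_compl_def linear_diff[OF linS] inner_simps)
  then show ?thesis using that[of p "v - p"] p(1) by simp
qed

text \<open>A vector of the complement with \<open>A w = 0\<close> would be orthogonal to itself in
  a definite inner product. This makes the coarse problem uniquely solvable.\<close>

lemma kernel_compl_definite:
  fixes A R :: "'a::euclidean_space \<Rightarrow> 'a"
  assumes A: "spsd_on UNIV A" and R: "spd_on UNIV (symmetrized A R)"
    and w: "w \<in> kernel_compl A R" "w \<noteq> 0"
  shows "A w \<bullet> w > 0"
proof -
  have "inv (symmetrized A R) w \<bullet> w > 0"
    using spd_on_inv(1)[OF R] w(2) by (simp add: spd_on_def)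
  then have "A w \<noteq> 0" using w(1) by (force simp: kernel_compl_def ker_on_def)
  then have "A w \<bullet> w \<noteq> 0" using spsd_on_eq_0[OF _ A, of w] by auto
  moreover have "A w \<bullet> w \<ge> 0" using A by (simp add: spsd_on_def)
  ultimately show ?thesis by simp
qed

text \<open>The projection is defined by testing on \<open>Vc \<inter> kernel_compl A R\<close>
  only. As \<open>Vc\<close> contains the kernel, each of its vectors is such a test vector plus a
  kernel vector, which is orthogonal to the range of the symmetric \<open>A\<close>; so
  orthogonality extends to all of \<open>Vc\<close>.\<close>

lemma coarse_proj_properties:
  fixes A R :: "'a::euclidean_space \<Rightarrow> 'a" and u :: 'a
  assumes A: "spsd_on UNIV A" and R: "spd_on UNIV (symmetrized A R)"
    and Vc: "subspace Vc" "ker_on UNIV A \<subseteq> Vc"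
  defines "p \<equiv> coarse_proj A (Vc \<inter> kernel_compl A R) u"
  shows "p \<in> Vc \<inter> kernel_compl A R" "\<And>v. v \<in> Vc \<Longrightarrow> A (u - p) \<bullet> v = 0"
proof -
  let ?Wc = "Vc \<inter> kernel_compl A R"
  have linA: "linear A" and sym: "\<And>x y. A x \<bullet> y = x \<bullet> A y"
    using A symmetric_on_UNIV_linear by (auto simp: spsd_on_def symmetric_on_def)
  have Wc: "subspace ?Wc" using Vc(1) subspace_kernel_compl[OF R] by (rule subspace_inter)
  have "linear_between ?Wc UNIV A"
    using linA by (auto simp: linear_between_def linear_add linear_scale)
  then obtain q where q: "q \<in> ?Wc" "\<And>v. v \<in> ?Wc \<Longrightarrow> A q \<bullet> v = A u \<bullet> v"
    using definite_form_represents[OF Wc, of UNIV A "A u"] kernel_compl_definite[OF A R] by auto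
  \<comment> \<open>Unique existence is what gives the description \<open>THE\<close> in
    \<open>coarse_proj\<close> its meaning.\<close>
  have "\<exists>!p. p \<in> ?Wc \<and> (\<forall>v\<in>?Wc. A p \<bullet> v = A u \<bullet> v)"
  proof (rule ex1I[of _ q])
    show "q \<in> ?Wc \<and> (\<forall>v\<in>?Wc. A q \<bullet> v = A u \<bullet> v)" using q by blast
    fix r assume r: "r \<in> ?Wc \<and> (\<forall>v\<in>?Wc. A r \<bullet> v = A u \<bullet> v)"
    then have d: "r - q \<in> ?Wc" using q(1) Wc subspace_diff by blast
    then have "A (r - q) \<bullet> (r - q) = 0"
      using r q(2)[OF d] by (simp add: linear_diff[OF linA] inner_diff_left)
    then show "r = q" using kernel_compl_definite[OF A R, of "r - q"] d by force
  qed
  then have p: "p \<in> ?Wc \<and> (\<forall>v\<in>?Wc. A p \<bullet> v = A u \<bullet> v)"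
    unfolding p_def coarse_proj_def by (rule theI')
  then show "p \<in> ?Wc" by blast
  fix v assume v: "v \<in> Vc"
  obtain n w where nw: "n \<in> ker_on UNIV A" "w \<in> kernel_compl A R" "v = n + w"
    using kernel_compl_decomp[OF A R] by blast
  have "w \<in> Vc" using v nw Vc by (metis add_diff_cancel_left' subsetD subspace_diff)
  then have "A (u - p) \<bullet> w = 0"
    using p nw(2) by (simp add: linear_diff[OF linA] inner_diff_left)
  moreover have "A (u - p) \<bullet> n = 0" using nw(1) sym[of "u - p" n] by (simp add: ker_on_def)
  ultimately show "A (u - p) \<bullet> v = 0" by (simp add: nw(3) inner_simps)
qed

text \<open>\<open>K\<close> collects the whole approximation property of the coarse space.
  Properness of \<open>Vc\<close> supplies a nonzero vector of the complement that survives the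
  coarse correction, so that the supremum has a nonempty range and \<open>1 - 1 / K\<close> is
  nonnegative.\<close>

lemma two_level_rate:
  fixes A R :: "'a::euclidean_space \<Rightarrow> 'a"
  assumes A: "spsd_on UNIV A" and R: "linear R" "spd_on UNIV (symmetrized A R)"
    and Vc: "subspace Vc" "ker_on UNIV A \<subseteq> Vc" "Vc \<noteq> UNIV"
    and K: "K > 0" "\<And>u. \<exists>v\<in>Vc. inv (symmetrized A R) (u - v) \<bullet> (u - v) \<le> K * (A u \<bullet> u)"
  shows "(energy_norm A R (error_prop A R Vc))\<^sup>2 \<le> 1 - 1 / K"
proof -
  let ?W = "kernel_compl A R" and ?E = "error_prop A R Vc" and ?Rs = "symmetrized A R"
  have Ann: "A v \<bullet> v \<ge> 0" for v using A by (simp add: spsd_on_def)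
  have linA: "linear A" and sym: "\<And>x y. A x \<bullet> y = x \<bullet> A y"
    using A symmetric_on_UNIV_linear by (auto simp: spsd_on_def symmetric_on_def)
  define pc where "pc w = coarse_proj A (Vc \<inter> ?W) w" for w
  note pc = coarse_proj_properties[OF A R(2) Vc(1,2), folded pc_def]
  have Ew: "?E w = (w - pc w) - R (A (w - pc w))" for w
    by (simp add: error_prop_def pc_def Let_def)
  have smooth: "A (?E w) \<bullet> ?E w \<le> (1 - 1 / K) * (A (w - pc w) \<bullet> (w - pc w))" for w
  proof -
    define u where "u = w - pc w"
    obtain v where v: "v \<in> Vc" "inv ?Rs (u - v) \<bullet> (u - v) \<le> K * (A u \<bullet> u)"
      using K(2) by blast
    have Rnn: "?Rs (A u) \<bullet> A u \<ge> 0"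
      using spd_on_imp_spsd_on[OF _ R(2)] by (simp add: spsd_on_def)
    have "A u \<bullet> u = A u \<bullet> (u - v)"
      using pc(2)[OF v(1), of w] by (simp add: u_def inner_diff_right)
    then have "(A u \<bullet> u)\<^sup>2 \<le> (?Rs (A u) \<bullet> A u) * (inv ?Rs (u - v) \<bullet> (u - v))"
      using dual_Cauchy_Schwarz[OF R(2), of "A u" "u - v"] by simp
    also have "\<dots> \<le> (?Rs (A u) \<bullet> A u) * (K * (A u \<bullet> u))"
      using v(2) Rnn by (rule mult_left_mono)
    finally have sq: "(A u \<bullet> u) * (A u \<bullet> u) \<le> (A u \<bullet> u) * (K * (?Rs (A u) \<bullet> A u))"
      by (simp add: power2_eq_square mult_ac)
    have "A u \<bullet> u \<le> K * (?Rs (A u) \<bullet> A u)"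
    proof (cases "A u \<bullet> u = 0")
      case True
      then show ?thesis using K(1) Rnn by simp
    next
      case False
      then have "A u \<bullet> u > 0" using Ann[of u] by simp
      then show ?thesis using sq by simp
    qed
    then have "(A u \<bullet> u) / K \<le> ?Rs (A u) \<bullet> A u" using K(1) by (simp add: field_simps)
    moreover have "A (?E w) \<bullet> ?E w = A u \<bullet> u - ?Rs (A u) \<bullet> A u"
      using smoother_energy[OF A R(1), of u] by (simp add: Ew u_def)
    ultimately show ?thesis by (simp add: u_def[symmetric] algebra_simps)
  qed
  \<comment> \<open>The coarse correction is an \<open>A\<close>-orthogonal projection, so
    Pythagoras applies.\<close>
  have proj: "A (w - pc w) \<bullet> (w - pc w) \<le> A w \<bullet> w" for w
  proof -
    have o: "A (w - pc w) \<bullet> pc w = 0" using pc(1)[of w] pc(2)[of "pc w" w] by simp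
    have o': "A (pc w) \<bullet> (w - pc w) = 0" using o sym[of "pc w" "w - pc w"]
      by (simp add: inner_commute)
    have "A w = A (w - pc w) + A (pc w)" by (simp add: linear_diff[OF linA])
    then have "A w \<bullet> w = (A (w - pc w) + A (pc w)) \<bullet> ((w - pc w) + pc w)" by simp
    also have "\<dots> = A (w - pc w) \<bullet> (w - pc w) + A (pc w) \<bullet> pc w"
      using o o' by (simp only: inner_add_left inner_add_right)
    finally show ?thesis using Ann[of "pc w"] by linarith
  qed
  obtain w0 where w0: "w0 \<in> ?W" "w0 \<notin> Vc"
  proof -
    obtain x where x: "x \<notin> Vc" using Vc(3) by auto
    obtain n w where nw: "n \<in> ker_on UNIV A" "w \<in> ?W" "x = n + w"
      using kernel_compl_decomp[OF A R(2)] by blast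
    then have "w \<notin> Vc" using x Vc(1,2) subspace_add by blast
    then show ?thesis using that nw(2) by blast
  qed
  have w0': "w0 \<noteq> 0" using w0 subspace_0[OF Vc(1)] by auto
  \<comment> \<open>The corrected \<open>w0\<close> has positive energy, while its smoothed image
    has nonnegative energy; \<open>smooth\<close> then forces the sign of the factor.\<close>
  have rate: "0 \<le> 1 - 1 / K"
  proof -
    let ?u = "w0 - pc w0"
    have "?u \<in> ?W"
      using w0(1) pc(1)[of w0] subspace_diff[OF subspace_kernel_compl[OF R(2)]] by blast
    moreover have "?u \<noteq> 0" using w0(2) pc(1)[of w0] by auto
    ultimately have "A ?u \<bullet> ?u > 0" using kernel_compl_definite[OF A R(2)] by blast
    moreover have "0 \<le> (1 - 1 / K) * (A ?u \<bullet> ?u)"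
      using smooth[of w0] Ann[of "?E w0"] by linarith
    ultimately show ?thesis by (simp add: zero_le_mult_iff)
  qed
  have bound: "op_norm_of A (?E w) / op_norm_of A w \<le> sqrt (1 - 1 / K)" for w
  proof (cases "A w \<bullet> w = 0")
    case True
    \<comment> \<open>The denominator vanishes and the quotient is 0 by convention.\<close>
    then show ?thesis using rate by (simp add: op_norm_of_def)
  next
    case False
    then have pos: "A w \<bullet> w > 0" using Ann[of w] by simp
    have "A (?E w) \<bullet> ?E w \<le> (1 - 1 / K) * (A w \<bullet> w)"
      using smooth[of w] mult_left_mono[OF proj[of w] rate] by linarith
    then have "sqrt ((A (?E w) \<bullet> ?E w) / (A w \<bullet> w)) \<le> sqrt (1 - 1 / K)"
      using pos by (intro real_sqrt_le_mono) (simp add: divide_le_eq)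
    then show ?thesis by (simp add: op_norm_of_def real_sqrt_divide)
  qed
  have ne: "?W - {0} \<noteq> {}" using w0(1) w0' by auto
  have upper: "energy_norm A R ?E \<le> sqrt (1 - 1 / K)"
    unfolding energy_norm_def using ne bound by (intro cSUP_least) auto
  \<comment> \<open>Squaring the upper bound requires the norm to be nonnegative, which one quotient
    in the supremum shows.\<close>
  have "0 \<le> op_norm_of A (?E w0) / op_norm_of A w0"
    using Ann by (simp add: op_norm_of_def)
  also have "\<dots> \<le> energy_norm A R ?E"
    unfolding energy_norm_def using bound w0(1) w0'
    by (intro cSUP_upper bdd_aboveI2[where M = "sqrt (1 - 1 / K)"]) auto
  finally have "(energy_norm A R ?E)\<^sup>2 \<le> (sqrt (1 - 1 / K))\<^sup>2"
    using upper by (intro power_mono)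
  then show ?thesis using rate by simp
qed

text \<open>The two bounds on \<open>\<mu>c\<close> guarantee that \<open>enn2real\<close> returns
  its value rather than the default 0 for infinity. Properness of \<open>Vc\<close> excludes the
  case \<open>Xc j = X j\<close> for all \<open>j\<close>, where every local constant is
  infinite.\<close>

theorem theorem6p9:
  fixes A R D :: "'a::euclidean_space \<Rightarrow> 'a"
    and J :: nat
    and X Xc :: "nat \<Rightarrow> 'b::euclidean_space set"
    and P :: "nat \<Rightarrow> 'b \<Rightarrow> 'a"
    and Aj Dj :: "nat \<Rightarrow> 'b \<Rightarrow> 'b"
    and c_lo c_up C1 C2 :: real
    and Vc :: "'a set" and \<mu>c :: ennreal
  defines "Vc \<equiv> sum_space J P Xc"
    and "\<mu>c \<equiv> coarse_const J X Aj Dj Xc"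
  assumes A: "spsd_on UNIV A"
    and R: "linear R" "spd_on UNIV (symmetrized A R)"
    and D: "spd_on UNIV D"
    and c_pos: "c_lo > 0" "c_up > 0"
    and c_bounds: "\<And>v. c_lo * (D v \<bullet> v) \<le> inv (symmetrized A R) v \<bullet> v"
      "\<And>v. inv (symmetrized A R) v \<bullet> v \<le> c_up * (D v \<bullet> v)"
    and X: "\<And>j. j \<in> {1..J} \<Longrightarrow> subspace (X j)"
    and P: "\<And>j. j \<in> {1..J} \<Longrightarrow> linear_between (X j) UNIV (P j)"
    and P_onto: "sum_space J P X = UNIV"
    and Aj: "\<And>j. j \<in> {1..J} \<Longrightarrow> spsd_on (X j) (Aj j)"
    and Dj: "\<And>j. j \<in> {1..J} \<Longrightarrow> spd_on (X j) (Dj j)"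
    and Xc: "\<And>j. j \<in> {1..J} \<Longrightarrow> subspace (Xc j) \<and> Xc j \<subseteq> X j"
    and C_pos: "C1 > 0" "C2 > 0"
    and cond1: "\<forall>w\<in>(\<Pi>\<^sub>E j\<in>{1..J}. X j).
      (op_norm_of D (sum_map J P w))\<^sup>2 \<le> C2 * (\<Sum>j\<in>{1..J}. (op_norm_of (Dj j) (w j))\<^sup>2)"
    and cond2: "\<forall>v. \<exists>w\<in>(\<Pi>\<^sub>E j\<in>{1..J}. X j). v = sum_map J P w \<and>
      (\<Sum>j\<in>{1..J}. (op_norm_of (Aj j) (w j))\<^sup>2) \<le> C1 * (op_norm_of A v)\<^sup>2"
    and cond3: "\<And>j. j \<in> {1..J} \<Longrightarrow> ker_on (X j) (Aj j) \<subseteq> Xc j"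
    and proper: "Vc \<noteq> UNIV"
  shows "0 < \<mu>c \<and> \<mu>c < \<infinity> \<and>
    (energy_norm A R (error_prop A R Vc))\<^sup>2 \<le> 1 - enn2real \<mu>c / (C1 * C2 * c_up)"
proof -
  \<comment> \<open>For \<open>J = 0\<close> the spaces built from \<open>X\<close> and
    \<open>Xc\<close> coincide, against properness. The minimum in \<open>coarse_const\<close> thus
    has a nonempty range.\<close>
  have J: "{1..J} \<noteq> {}"
  proof
    assume "{1..J} = {}"
    then show False using P_onto proper by (simp add: Vc_def sum_space_def)
  qed
  have XcX: "subspace (Xc j)" "Xc j \<subseteq> X j" if "j \<in> {1..J}" for j using Xc[OF that] by auto
  have Djps: "spsd_on (X j) (Dj j)" if "j \<in> {1..J}" for j
    using spd_on_imp_spsd_on[OF X Dj] that by blast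
  have Dnn: "spsd_on UNIV D" using spd_on_imp_spsd_on[OF _ D] by simp
  have Vc_sub: "subspace Vc"
    unfolding Vc_def
  proof (rule subspace_sum_space)
    fix j assume "j \<in> {1..J}"
    then show "subspace (Xc j)" "linear_between (Xc j) UNIV (P j)"
      using XcX P by (auto simp: linear_between_def subset_iff)
  qed
  have mu_le: "\<mu>c \<le> local_const (X j) (Aj j) (Dj j) (Xc j)" if "j \<in> {1..J}" for j
    unfolding \<mu>c_def coarse_const_def using that by (intro Min_le) auto
  have "local_const (X j) (Aj j) (Dj j) (Xc j) > 0" if "j \<in> {1..J}" for j
    using local_const_pos[OF X Aj Dj XcX cond3, OF that that that that that that] .
  moreover have "\<mu>c \<in> (\<lambda>j. local_const (X j) (Aj j) (Dj j) (Xc j)) ` {1..J}"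
    unfolding \<mu>c_def coarse_const_def using J by (intro Min_in) auto
  ultimately have mu_pos: "\<mu>c > 0" by auto
  \<comment> \<open>Stated for any real \<open>M\<close> above the reciprocal, since finiteness of
    \<open>\<mu>c\<close> is still open: \<open>M = 0\<close> will prove it, and
    \<open>M = 1 / m\<close> will give the rate.\<close>
  have Vc_approx: "\<exists>v\<in>Vc. inv (symmetrized A R) (u - v) \<bullet> (u - v) \<le> M * C1 * C2 * c_up * (A u \<bullet> u)"
    if M: "inverse \<mu>c \<le> ennreal M" "M \<ge> 0" for M u
  proof -
    obtain w where w: "w \<in> (\<Pi>\<^sub>E j\<in>{1..J}. X j)" "u = sum_map J P w"
      "(\<Sum>j\<in>{1..J}. (op_norm_of (Aj j) (w j))\<^sup>2) \<le> C1 * (op_norm_of A u)\<^sup>2"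
      using cond2 by blast
    have wX: "w j \<in> X j" if "j \<in> {1..J}" for j using w(1) that by (auto dest: PiE_mem)
    have "\<exists>t\<in>Xc j. Dj j (w j - t) \<bullet> (w j - t) \<le> M * (Aj j (w j) \<bullet> w j)"
      if j: "j \<in> {1..J}" for j
    proof -
      have "inverse (local_const (X j) (Aj j) (Dj j) (Xc j)) \<le> ennreal M"
        using M(1) ennreal_inverse_antimono[OF mu_le[OF j]] by (rule order_trans[rotated])
      then show ?thesis
        using local_approximation[OF X Aj Dj XcX cond3, OF j j j j j j] M(2) wX[OF j] by blast
    qed
    then obtain t where t: "\<And>j. j \<in> {1..J} \<Longrightarrow> t j \<in> Xc j"
      "\<And>j. j \<in> {1..J} \<Longrightarrow> Dj j (w j - t j) \<bullet> (w j - t j) \<le> M * (Aj j (w j) \<bullet> w j)"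
      by metis
    define v where "v = sum_map J P (restrict t {1..J})"
    have vVc: "v \<in> Vc" unfolding v_def Vc_def sum_space_def using t(1) by auto
    define d where "d = (\<lambda>j\<in>{1..J}. w j - t j)"
    have dX: "d j \<in> X j" if "j \<in> {1..J}" for j
      using subspace_diff[OF X[OF that] wX[OF that]] XcX(2)[OF that] t(1)[OF that] that
      by (auto simp: d_def)
    have dP: "d \<in> (\<Pi>\<^sub>E j\<in>{1..J}. X j)" using dX by (auto simp: d_def)
    have uv: "u - v = sum_map J P d"
      unfolding w(2) v_def sum_map_def sum_subtractf[symmetric]
    proof (rule sum.cong[OF refl])
      fix j assume j: "j \<in> {1..J}"
      then have "t j \<in> X j" using t(1) XcX(2) by blast
      then show "P j (w j) - P j (restrict t {1..J} j) = P j (d j)"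
        using linear_between_diff[OF P[OF j] X[OF j] wX[OF j]] j by (simp add: d_def)
    qed
    \<comment> \<open>The chain uses condition (1) on the differences \<open>d\<close>, then the
      local approximation, then the stability from condition (2).\<close>
    have "D (u - v) \<bullet> (u - v) \<le> C2 * (\<Sum>j\<in>{1..J}. (op_norm_of (Dj j) (d j))\<^sup>2)"
      using cond1[rule_format, OF dP] op_norm_of_power2[OF Dnn] by (simp add: uv)
    also have "\<dots> \<le> C2 * (\<Sum>j\<in>{1..J}. M * (op_norm_of (Aj j) (w j))\<^sup>2)"
      using C_pos t(2) op_norm_of_power2[OF Djps dX] op_norm_of_power2[OF Aj wX]
      by (intro mult_left_mono sum_mono) (auto simp: d_def)
    also have "\<dots> \<le> C2 * (M * (C1 * (op_norm_of A u)\<^sup>2))"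
      unfolding sum_distrib_left[symmetric] using w(3) C_pos M(2)
      by (intro mult_left_mono) auto
    finally have Dd: "D (u - v) \<bullet> (u - v) \<le> M * C1 * C2 * (A u \<bullet> u)"
      using op_norm_of_power2[OF A] by (simp add: mult_ac)
    have "inv (symmetrized A R) (u - v) \<bullet> (u - v) \<le> c_up * (D (u - v) \<bullet> (u - v))"
      by (rule c_bounds(2))
    also have "\<dots> \<le> c_up * (M * C1 * C2 * (A u \<bullet> u))"
      using Dd c_pos by (intro mult_left_mono) auto
    finally show ?thesis using vVc by (auto simp: mult_ac intro!: bexI[of _ v])
  qed
  have definite: "v = 0" if "inv (symmetrized A R) v \<bullet> v \<le> 0" for v
    using that spd_on_inv(1)[OF R(2)] by (force simp: spd_on_def)
  \<comment> \<open>With an infinite constant, \<open>M = 0\<close> is allowed; every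
    \<open>u\<close> then equals its coarse approximant, and \<open>Vc\<close> would be
    everything.\<close>
  have mu_fin: "\<mu>c < \<infinity>"
  proof (rule ccontr)
    assume "\<not> \<mu>c < \<infinity>"
    then have "inverse \<mu>c \<le> ennreal 0" by (simp add: less_top[symmetric])
    have "u \<in> Vc" for u
    proof -
      obtain v where "v \<in> Vc" "inv (symmetrized A R) (u - v) \<bullet> (u - v) \<le> 0"
        using Vc_approx[OF \<open>inverse \<mu>c \<le> ennreal 0\<close>, of u] by auto
      then show ?thesis using definite[of "u - v"] by simp
    qed
    then show False using proper by auto
  qed
  define m where "m = enn2real \<mu>c"
  have m: "m > 0" "\<mu>c = ennreal m"
    using mu_pos mu_fin by (auto simp: m_def enn2real_positive_iff)
  then have inv: "inverse \<mu>c \<le> ennreal (1 / m)" by (simp add: inverse_ennreal inverse_eq_divide)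
  define K where "K = 1 / m * C1 * C2 * c_up"
  have K: "K > 0" using m C_pos c_pos by (simp add: K_def)
  have approx: "\<exists>v\<in>Vc. inv (symmetrized A R) (u - v) \<bullet> (u - v) \<le> K * (A u \<bullet> u)" for u
    unfolding K_def using Vc_approx[OF inv] m by simp
  \<comment> \<open>For a kernel vector the right-hand side of \<open>approx\<close> is 0, so it
    coincides with its approximant; condition (3) enters through
    \<open>local_approximation\<close>.\<close>
  have "ker_on UNIV A \<subseteq> Vc"
  proof
    fix n assume "n \<in> ker_on UNIV A"
    then obtain v where "v \<in> Vc" "inv (symmetrized A R) (n - v) \<bullet> (n - v) \<le> 0"
      using approx[of n] by (auto simp: ker_on_def)
    then show "n \<in> Vc" using definite[of "n - v"] by simp
  qed
  from two_level_rate[OF A R Vc_sub this proper K approx]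
  have "(energy_norm A R (error_prop A R Vc))\<^sup>2 \<le> 1 - m / (C1 * C2 * c_up)"
    using m by (simp add: K_def)
  then show ?thesis using mu_pos mu_fin by (simp add: m_def)
qed

end
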